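(* Let $g\ge 1$ and let $\phi:\pi_1(S_g)\to F(a_1,\dots,a_g)\times F(b_1,\dots,b_g)$ be a homomorphism of the form $\phi(x_i)=b_i\,u_i$, $\phi(y_i)=v_i$ $(1\le i\le g)$, where $u_i,v_i\in F(a_1,\dots,a_g)$ satisfy $[u_1,v_1]\cdots[u_g,v_g]=1$ and the elements $u_1,v_1,\dots,u_g,v_g$ generate $F(a_1,\dots,a_g)$. Then $\phi$ is surjective if and only if the group $$G_\phi=\langle a_1,\dots,a_g\mid v_1,\dots,v_g\rangle$$ is trivial.
   Context: $S_g$ is the closed orientable surface of genus $g$, with $\pi_1(S_g)=\langle x_1,y_1,\dots,x_g,y_g\mid [x_1,y_1]\cdots[x_g,y_g]=1\rangle$. $F(a_1,\dots,a_g)$ and $F(b_1,\dots,b_g)$ are free groups with the indicated bases; each is regarded as a subgroup of the direct product, so $b_iu_i$ denotes the element with $a$-coordinate $u_i$ and $b$-coordinate $b_i$, and $v_i$ denotes the element with $a$-coordinate $v_i$ and trivial $b$-coordinate. *)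

theory Defs
  imports "HOL.Hull" "HOL-Algebra.Generated_Groups" "HOL-Algebra.Elementary_Groups"
begin

section \<open>Free groups\<close>

text \<open>
  A letter is a generator together with an exponent: \<open>(x, True)\<close> stands for \<open>x\<close> and
  \<open>(x, False)\<close> for its formal inverse.  Elements of the free group on \<open>S\<close> are the freely reduced
  words in these letters, multiplied by concatenation followed by free reduction.
\<close>

type_synonym 'a word = "('a \<times> bool) list"

definition flip :: "'a \<times> bool \<Rightarrow> 'a \<times> bool" where
  "flip l = (fst l, \<not> snd l)"

definition reduced :: "'a word \<Rightarrow> bool" where
  "reduced w \<longleftrightarrow> successively (\<lambda>l m. m \<noteq> flip l) w"

fun cons_reduce :: "'a \<times> bool \<Rightarrow> 'a word \<Rightarrow> 'a word" where
  "cons_reduce l [] = [l]"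
| "cons_reduce l (m # w) = (if m = flip l then w else l # m # w)"

definition free_group :: "'a set \<Rightarrow> 'a word monoid" where
  "free_group S =
    \<lparr>carrier = {w. reduced w \<and> fst ` set w \<subseteq> S},
     mult = foldr cons_reduce,
     one = []\<rparr>"

definition free_gen :: "'a \<Rightarrow> 'a word" where
  "free_gen x = [(x, True)]"

lemma flip_flip [simp]: "flip (flip l) = l"
  by (simp add: flip_def)

lemma flip_neq [simp]: "flip l \<noteq> l" "l \<noteq> flip l"
  by (simp_all add: flip_def prod_eq_iff)

lemma flip_eq_iff: "flip l = m \<longleftrightarrow> l = flip m"
  by (metis flip_flip)

lemma fst_flip [simp]: "fst (flip l) = fst l"
  by (simp add: flip_def)

lemma reduced_Nil [simp]: "reduced []"
  and reduced_single [simp]: "reduced [l]"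
  and reduced_Cons_Cons [simp]: "reduced (l # m # w) \<longleftrightarrow> m \<noteq> flip l \<and> reduced (m # w)"
  by (simp_all add: reduced_def)

lemma reduced_ConsD: "reduced (l # w) \<Longrightarrow> reduced w"
  by (cases w) auto

lemma reduced_cons_reduce: "reduced w \<Longrightarrow> reduced (cons_reduce l w)"
  by (cases w) (auto dest: reduced_ConsD)

lemma cons_reduce_reduced: "reduced (l # w) \<Longrightarrow> cons_reduce l w = l # w"
  by (cases w) auto

lemma cons_reduce_flip: "reduced w \<Longrightarrow> cons_reduce l (cons_reduce (flip l) w) = w"
  by (cases w) (auto simp: cons_reduce_reduced)

lemma set_cons_reduce: "set (cons_reduce l w) \<subseteq> insert l (set w)"
  by (cases w) auto

lemma reduced_foldr: "reduced ys \<Longrightarrow> reduced (foldr cons_reduce xs ys)"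
  by (induction xs) (auto simp: reduced_cons_reduce)

lemma set_foldr: "set (foldr cons_reduce xs ys) \<subseteq> set xs \<union> set ys"
proof (induction xs)
  case (Cons l xs)
  then show ?case
    using set_cons_reduce[of l "foldr cons_reduce xs ys"] by auto
qed simp

lemma foldr_cons_reduce:
  assumes "reduced zs"
  shows "foldr cons_reduce (cons_reduce l w) zs = cons_reduce l (foldr cons_reduce w zs)"
proof (cases w)
  case (Cons m w')
  have "reduced (foldr cons_reduce w' zs)"
    by (rule reduced_foldr [OF assms])
  then show ?thesis
    using Cons by (auto simp: cons_reduce_flip)
qed simp

lemma foldr_cons_reduce_assoc:
  assumes "reduced zs"
  shows "foldr cons_reduce (foldr cons_reduce xs ys) zs = foldr cons_reduce xs (foldr cons_reduce ys zs)"
  by (induction xs) (simp_all add: foldr_cons_reduce assms)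

lemma foldr_cons_reduce_Nil: "reduced w \<Longrightarrow> foldr cons_reduce w [] = w"
  proof (induction w)
  case (Cons l w)
  then show ?case
    using cons_reduce_reduced[of l w] reduced_ConsD[of l w] by simp
qed simp

lemma cons_reduce_left_inverse:
  assumes "reduced w"
  shows "\<exists>w'. fst ` set w' \<subseteq> fst ` set w \<and> reduced w' \<and> foldr cons_reduce w' w = []"
  using assms
proof (induction w)
  case (Cons l w)
  then obtain w' where w': "fst ` set w' \<subseteq> fst ` set w" "reduced w'" "foldr cons_reduce w' w = []"
    using reduced_ConsD by blast
  let ?v = "foldr cons_reduce w' [flip l]"
  have "foldr cons_reduce ?v (l # w) = foldr cons_reduce w' (foldr cons_reduce [flip l] (l # w))"
    by (rule foldr_cons_reduce_assoc [OF Cons.prems])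
  then have "foldr cons_reduce ?v (l # w) = []"
    using w' by simp
  moreover have "fst ` set ?v \<subseteq> fst ` set (l # w)"
    using set_foldr[of w' "[flip l]"] w'(1) by fastforce
  ultimately show ?case
    using reduced_foldr[of "[flip l]" w'] by auto
qed auto

lemma group_free_group: "group (free_group S)"
proof (rule groupI)
  fix x y assume "x \<in> carrier (free_group S)" "y \<in> carrier (free_group S)"
  then show "x \<otimes>\<^bsub>free_group S\<^esub> y \<in> carrier (free_group S)"
    using set_foldr[of x y] by (fastforce simp: free_group_def reduced_foldr)
next
  fix x assume "x \<in> carrier (free_group S)"
  then show "\<exists>y\<in>carrier (free_group S). y \<otimes>\<^bsub>free_group S\<^esub> x = \<one>\<^bsub>free_group S\<^esub>"
    using cons_reduce_left_inverse[of x] by (fastforce simp: free_group_def)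
qed (auto simp: free_group_def foldr_cons_reduce_assoc)

lemma free_gen_closed: "x \<in> S \<Longrightarrow> free_gen x \<in> carrier (free_group S)"
  by (simp add: free_gen_def free_group_def)

lemma inv_free_gen:
  assumes "x \<in> S"
  shows "inv\<^bsub>free_group S\<^esub> (free_gen x) = [(x, False)]"
  by (rule group.inv_equality [OF group_free_group])
    (use assms in \<open>auto simp: free_group_def free_gen_def flip_def\<close>)

lemma free_group_generate: "generate (free_group S) (free_gen ` S) = carrier (free_group S)"
proof
  interpret F: group "free_group S" by (rule group_free_group)
  show "generate (free_group S) (free_gen ` S) \<subseteq> carrier (free_group S)"
    by (rule F.generate_incl) (auto simp: free_gen_closed)
  have "w \<in> generate (free_group S) (free_gen ` S)" if "reduced w" "fst ` set w \<subseteq> S" for w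
    using that
  proof (induction w)
    case Nil
    then show ?case
      using generate.one[of "free_group S"] by (simp add: free_group_def)
  next
    case (Cons l w)
    have w: "w \<in> generate (free_group S) (free_gen ` S)"
      using Cons.IH Cons.prems reduced_ConsD[of l w] by simp
    obtain x b where l: "l = (x, b)" by (cases l)
    have "[l] \<in> generate (free_group S) (free_gen ` S)"
    proof (cases b)
      case True
      then have "[l] = free_gen x" by (simp add: l free_gen_def)
      then show ?thesis using Cons.prems l by (simp add: generate.incl)
    next
      case False
      then have "[l] = inv\<^bsub>free_group S\<^esub> (free_gen x)"
        using Cons.prems l by (simp add: inv_free_gen)
      then show ?thesis using Cons.prems l by (simp add: generate.inv)
    qed
    from generate.eng [OF this w] show ?case
      using Cons.prems by (simp add: free_group_def cons_reduce_reduced)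
  qed
  then show "carrier (free_group S) \<subseteq> generate (free_group S) (free_gen ` S)"
    by (auto simp: free_group_def)
qed

text \<open>The extension in the universal property of the free group.\<close>

definition word_eval :: "('b, 'c) monoid_scheme \<Rightarrow> ('a \<Rightarrow> 'b) \<Rightarrow> 'a word \<Rightarrow> 'b" where
  "word_eval G f w =
    foldr (\<lambda>(x, b) p. (if b then f x else inv\<^bsub>G\<^esub> (f x)) \<otimes>\<^bsub>G\<^esub> p) w \<one>\<^bsub>G\<^esub>"

lemma word_eval_hom:
  assumes "group G" and f: "f ` S \<subseteq> carrier G"
  shows "word_eval G f \<in> hom (free_group S) G"
    and "\<And>x. x \<in> S \<Longrightarrow> word_eval G f (free_gen x) = f x"
proof -
  interpret G: group G by fact
  have closed: "word_eval G f w \<in> carrier G" if "fst ` set w \<subseteq> S" for w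
    using that f by (induction w) (auto simp: word_eval_def image_subset_iff)
  have cons: "word_eval G f (cons_reduce (x, b) w)
      = (if b then f x else inv\<^bsub>G\<^esub> (f x)) \<otimes>\<^bsub>G\<^esub> word_eval G f w"
    if "x \<in> S" "fst ` set w \<subseteq> S" for x b w
  proof (cases w)
    case (Cons m w')
    have "f x \<in> carrier G" "word_eval G f w' \<in> carrier G"
      using that f closed Cons by auto
    then show ?thesis
      using Cons by (auto simp: word_eval_def flip_def G.m_assoc [symmetric])
  qed (simp add: word_eval_def)
  have "word_eval G f (foldr cons_reduce v w) = word_eval G f v \<otimes>\<^bsub>G\<^esub> word_eval G f w"
    if "fst ` set v \<subseteq> S" "fst ` set w \<subseteq> S" for v w
    using that(1)
  proof (induction v)
    case Nil
    then show ?case using closed that(2) by (simp add: word_eval_def)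
  next
    case (Cons l v)
    obtain x b where l: "l = (x, b)" by (cases l)
    have "fst ` set (foldr cons_reduce v w) \<subseteq> S"
      using set_foldr[of v w] Cons.prems that(2) by fastforce
    moreover have "f x \<in> carrier G" "x \<in> S"
      using Cons.prems l f by auto
    moreover have "word_eval G f v \<in> carrier G" "word_eval G f w \<in> carrier G"
      using closed Cons.prems that(2) by auto
    moreover have "word_eval G f (l # v)
        = (if b then f x else inv\<^bsub>G\<^esub> (f x)) \<otimes>\<^bsub>G\<^esub> word_eval G f v"
      by (simp add: word_eval_def l)
    ultimately show ?case
      using Cons cons[of x "foldr cons_reduce v w" b] by (simp add: l G.m_assoc)
  qed
  then show "word_eval G f \<in> hom (free_group S) G"
    using closed by (auto simp: hom_def free_group_def)
  show "word_eval G f (free_gen x) = f x" if "x \<in> S" for x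
    using that f by (auto simp: word_eval_def free_gen_def)
qed

section \<open>Presentations\<close>

definition normal_closure :: "('a, 'b) monoid_scheme \<Rightarrow> 'a set \<Rightarrow> 'a set" where
  "normal_closure G R = (\<lambda>N. N \<lhd> G) hull R"

text \<open>
  \<open>presented_group S R\<close> is \<open>\<langle>S | R\<rangle>\<close>, where the relators are given as elements of the free group
  on \<open>S\<close>; it is only meaningful for \<open>R \<subseteq> carrier (free_group S)\<close>.  Its elements are cosets, and
  \<open>presented_gen S R x\<close> is the coset of the generator \<open>x\<close>.
\<close>

definition presented_group :: "'a set \<Rightarrow> 'a word set \<Rightarrow> 'a word set monoid" where
  "presented_group S R = free_group S Mod normal_closure (free_group S) R"

definition presented_gen :: "'a set \<Rightarrow> 'a word set \<Rightarrow> 'a \<Rightarrow> 'a word set" where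
  "presented_gen S R x = normal_closure (free_group S) R #>\<^bsub>free_group S\<^esub> free_gen x"

lemma (in group) normal_normal_closure:
  assumes "R \<subseteq> carrier G"
  shows "normal_closure G R \<lhd> G"
proof -
  let ?A = "{N. N \<lhd> G \<and> R \<subseteq> N}"
  have "carrier G \<lhd> G"
    by (simp add: normal_inv_iff subgroup_self)
  then have "?A \<noteq> {}"
    using assms by blast
  then have "subgroup (\<Inter>?A) G"
    by (intro subgroups_Inter) (auto simp: normal_inv_iff)
  then show ?thesis
    unfolding normal_closure_def hull_def by (auto simp: normal_inv_iff)
qed

lemma group_presented_group:
  assumes "R \<subseteq> carrier (free_group S)"
  shows "group (presented_group S R)"
  unfolding presented_group_def
  by (intro normal.factorgroup_is_group group.normal_normal_closure group_free_group assms)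

section \<open>Surface groups\<close>

definition commutator :: "('a, 'b) monoid_scheme \<Rightarrow> 'a \<Rightarrow> 'a \<Rightarrow> 'a" where
  "commutator G x y = x \<otimes>\<^bsub>G\<^esub> y \<otimes>\<^bsub>G\<^esub> inv\<^bsub>G\<^esub> x \<otimes>\<^bsub>G\<^esub> inv\<^bsub>G\<^esub> y"

text \<open>The ordered product \<open>[x\<^sub>1, y\<^sub>1] \<cdots> [x\<^sub>g, y\<^sub>g]\<close>.\<close>

definition commutator_prod ::
  "('a, 'b) monoid_scheme \<Rightarrow> nat \<Rightarrow> (nat \<Rightarrow> 'a) \<Rightarrow> (nat \<Rightarrow> 'a) \<Rightarrow> 'a" where
  "commutator_prod G g x y =
    foldr (\<lambda>i p. commutator G (x i) (y i) \<otimes>\<^bsub>G\<^esub> p) [1..<Suc g] \<one>\<^bsub>G\<^esub>"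

datatype surface_letter = Gen_X nat | Gen_Y nat

definition surface_letters :: "nat \<Rightarrow> surface_letter set" where
  "surface_letters g = Gen_X ` {1..g} \<union> Gen_Y ` {1..g}"

definition surface_relators :: "nat \<Rightarrow> surface_letter word set" where
  "surface_relators g =
    {commutator_prod (free_group (surface_letters g)) g (\<lambda>i. free_gen (Gen_X i)) (\<lambda>i. free_gen (Gen_Y i))}"

definition surface_group :: "nat \<Rightarrow> surface_letter word set monoid" where
  "surface_group g = presented_group (surface_letters g) (surface_relators g)"

definition surface_x :: "nat \<Rightarrow> nat \<Rightarrow> surface_letter word set" where
  "surface_x g i = presented_gen (surface_letters g) (surface_relators g) (Gen_X i)"

definition surface_y :: "nat \<Rightarrow> nat \<Rightarrow> surface_letter word set" where
  "surface_y g i = presented_gen (surface_letters g) (surface_relators g) (Gen_Y i)"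

lemma (in group) commutator_prod_closed:
  assumes "\<And>i. i \<in> {1..g} \<Longrightarrow> x i \<in> carrier G" "\<And>i. i \<in> {1..g} \<Longrightarrow> y i \<in> carrier G"
  shows "commutator_prod G g x y \<in> carrier G"
proof -
  have "foldr (\<lambda>i p. commutator G (x i) (y i) \<otimes> p) is \<one> \<in> carrier G" if "set is \<subseteq> {1..g}" for "is"
    using that by (induction "is") (auto simp: commutator_def assms)
  then show ?thesis
    unfolding commutator_prod_def
    by (auto simp del: upt_Suc simp: atLeastLessThanSuc_atLeastAtMost)
qed

lemma surface_relators_closed:
  "surface_relators g \<subseteq> carrier (free_group (surface_letters g))"
  unfolding surface_relators_def
  by (auto intro!: group.commutator_prod_closed group_free_group free_gen_closed
      simp: surface_letters_def)

lemma group_surface_group: "group (surface_group g)"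
  unfolding surface_group_def by (rule group_presented_group [OF surface_relators_closed])

text \<open>
  The free group \<open>F(a\<^sub>1, \<dots>, a\<^sub>g)\<close>, with \<open>a\<^sub>i = free_gen i\<close>.  A second copy of the same group, in
  the second factor of a direct product, serves as \<open>F(b\<^sub>1, \<dots>, b\<^sub>g)\<close>.
\<close>

abbreviation free_group_rank :: "nat \<Rightarrow> nat word monoid" where
  "free_group_rank g \<equiv> free_group {1..g}"

end

theory Submission
  imports Defs
begin

text \<open>
  Write \<open>F\<close> for the free group in either coordinate and \<open>N\<close> for the normal closure of the \<open>v\<^sub>i\<close>
  in \<open>F\<close>.  The image of \<open>\<phi>\<close> is the subgroup \<open>I\<close> of \<open>F \<times> F\<close> generated by the pairs
  \<open>(u\<^sub>i, b\<^sub>i)\<close> and \<open>(v\<^sub>i, 1)\<close>, and the whole question is how \<open>I\<close> meets the first factor.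
  The answer is \<open>I \<inter> (F \<times> 1) = N \<times> 1\<close>, for two reasons.

  On the one hand, the \<open>u\<^sub>i\<close> and \<open>v\<^sub>i\<close> generate \<open>F\<close>, so \<open>I\<close> projects onto the first factor;
  conjugation inside \<open>I\<close> therefore realises every conjugation of \<open>F \<times> 1\<close>, and
  \<open>I \<inter> (F \<times> 1)\<close> is normal in the first factor.  It contains the \<open>v\<^sub>i\<close>, hence \<open>N\<close>.  On the other
  hand, since the \<open>b\<^sub>i\<close> are a free basis there is a homomorphism \<open>\<psi> : F \<rightarrow> F / N\<close> sending \<open>b\<^sub>i\<close> to
  the coset of \<open>u\<^sub>i\<close>.  The pairs \<open>(p, q)\<close> with \<open>N p = \<psi>(q)\<close> form a subgroup containing the
  generators of \<open>I\<close>, so \<open>(w, 1) \<in> I\<close> forces \<open>N w = \<psi>(1) = N\<close>.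

  Because \<open>I\<close> also projects onto the second factor, \<open>I\<close> is everything if and only if it contains
  the first factor, that is, if and only if \<open>N = F\<close>, which says that \<open>G\<^sub>\<phi> = F / N\<close> is trivial.
  Lemma \<open>generate_DirProd_free_group_eq_carrier_iff\<close> is this argument with an arbitrary group as
  the first factor; \<open>normal_slice_DirProd\<close> and \<open>generate_DirProd_free_group_subset\<close> carry the two
  inclusions.
\<close>

section \<open>Generators and triviality of a presented group\<close>

lemma (in normal) Mod_trivial_iff: "trivial_group (G Mod H) \<longleftrightarrow> H = carrier G"
proof
  assume "trivial_group (G Mod H)"
  then have "H #> x = H" if "x \<in> carrier G" for x
    using that by (auto simp: trivial_group_def FactGroup_def RCOSETS_def)
  then show "H = carrier G"
    using rcos_self[OF _ is_subgroup] subset by blast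
next
  assume H: "H = carrier G"
  have "carrier (G Mod H) = {H}"
    unfolding FactGroup_def RCOSETS_def
    using H coset_join2[OF _ is_subgroup] one_closed by auto
  then show "trivial_group (G Mod H)"
    by (simp add: trivial_group_def factorgroup_is_group)
qed

lemma trivial_presented_group_iff:
  assumes "R \<subseteq> carrier (free_group S)"
  shows "trivial_group (presented_group S R)
    \<longleftrightarrow> normal_closure (free_group S) R = carrier (free_group S)"
  unfolding presented_group_def
  by (intro normal.Mod_trivial_iff group.normal_normal_closure group_free_group assms)

lemma presented_group_generate:
  assumes "R \<subseteq> carrier (free_group S)"
  shows "generate (presented_group S R) (presented_gen S R ` S) = carrier (presented_group S R)"
proof -
  let ?F = "free_group S" and ?N = "normal_closure (free_group S) R"
  interpret N: normal ?N ?F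
    by (intro group.normal_normal_closure group_free_group assms)
  have hom: "group_hom ?F (presented_group S R) (\<lambda>w. ?N #>\<^bsub>?F\<^esub> w)"
    unfolding presented_group_def
    by (intro group_hom.intro group_hom_axioms.intro group_free_group N.factorgroup_is_group
        N.r_coset_hom_Mod)
  have "generate (presented_group S R) ((\<lambda>w. ?N #>\<^bsub>?F\<^esub> w) ` free_gen ` S)
      = (\<lambda>w. ?N #>\<^bsub>?F\<^esub> w) ` carrier ?F"
    using group_hom.generate_img[OF hom, of "free_gen ` S"]
    by (simp add: free_group_generate free_gen_closed image_subset_iff)
  then show ?thesis
    by (auto simp: image_image presented_gen_def presented_group_def FactGroup_def RCOSETS_def)
qed

lemma surface_group_generate:
  "generate (surface_group g) (surface_x g ` {1..g} \<union> surface_y g ` {1..g})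
    = carrier (surface_group g)"
  using presented_group_generate[OF surface_relators_closed, of g]
  by (simp add: surface_group_def surface_x_def[abs_def] surface_y_def[abs_def]
      surface_letters_def image_Un image_image)

section \<open>Normal closures and products with a free group\<close>

lemma (in group) normal_closure_incl: "R \<subseteq> normal_closure G R"
  unfolding normal_closure_def by (rule hull_subset)

lemma (in group) normal_closure_minimal:
  "R \<subseteq> N \<Longrightarrow> N \<lhd> G \<Longrightarrow> normal_closure G R \<subseteq> N"
  unfolding normal_closure_def by (rule hull_minimal)

text \<open>
  An element of a subgroup \<open>I\<close> lying over \<open>h\<close> conjugates the elements \<open>(w, 1)\<close> of \<open>I\<close> exactly as
  \<open>h\<close> conjugates \<open>w\<close>, whatever its second coordinate is.
\<close>

lemma normal_slice_DirProd:
  assumes "group G" "group H" and I: "subgroup I (G \<times>\<times> H)" and onto: "fst ` I = carrier G"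
  shows "{w. (w, \<one>\<^bsub>H\<^esub>) \<in> I} \<lhd> G"
proof -
  interpret G: group G by fact
  interpret H: group H by fact
  interpret I: subgroup I "G \<times>\<times> H" by fact
  have I_mem: "p \<in> carrier G" "q \<in> carrier H" if "(p, q) \<in> I" for p q
    using I.subset that by (auto simp: DirProd_def)
  have I_mult: "(p \<otimes>\<^bsub>G\<^esub> p', q \<otimes>\<^bsub>H\<^esub> q') \<in> I" if "(p, q) \<in> I" "(p', q') \<in> I" for p q p' q'
    using I.m_closed[OF that] by simp
  have I_inv: "(inv\<^bsub>G\<^esub> p, inv\<^bsub>H\<^esub> q) \<in> I" if "(p, q) \<in> I" for p q
    using I.m_inv_closed[OF that] I_mem[OF that] by (simp add: inv_DirProd assms(1,2))
  show ?thesis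
    unfolding G.normal_inv_iff
  proof (intro conjI ballI)
    show "subgroup {w. (w, \<one>\<^bsub>H\<^esub>) \<in> I} G"
    proof
      show "{w. (w, \<one>\<^bsub>H\<^esub>) \<in> I} \<subseteq> carrier G" using I_mem by auto
      show "\<one>\<^bsub>G\<^esub> \<in> {w. (w, \<one>\<^bsub>H\<^esub>) \<in> I}" using I.one_closed by simp
    next
      fix x y assume "x \<in> {w. (w, \<one>\<^bsub>H\<^esub>) \<in> I}" "y \<in> {w. (w, \<one>\<^bsub>H\<^esub>) \<in> I}"
      then show "x \<otimes>\<^bsub>G\<^esub> y \<in> {w. (w, \<one>\<^bsub>H\<^esub>) \<in> I}"
        using I_mult[of x "\<one>\<^bsub>H\<^esub>" y "\<one>\<^bsub>H\<^esub>"] by simp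
    next
      fix x assume "x \<in> {w. (w, \<one>\<^bsub>H\<^esub>) \<in> I}"
      then show "inv\<^bsub>G\<^esub> x \<in> {w. (w, \<one>\<^bsub>H\<^esub>) \<in> I}"
        using I_inv[of x "\<one>\<^bsub>H\<^esub>"] by simp
    qed
  next
    fix h w assume "h \<in> carrier G" and w: "w \<in> {w. (w, \<one>\<^bsub>H\<^esub>) \<in> I}"
    then obtain c where hc: "(h, c) \<in> I"
      using onto by force
    then have "(h \<otimes>\<^bsub>G\<^esub> w \<otimes>\<^bsub>G\<^esub> inv\<^bsub>G\<^esub> h, c \<otimes>\<^bsub>H\<^esub> \<one>\<^bsub>H\<^esub> \<otimes>\<^bsub>H\<^esub> inv\<^bsub>H\<^esub> c) \<in> I"
      using w I_mult I_inv by blast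
    then show "h \<otimes>\<^bsub>G\<^esub> w \<otimes>\<^bsub>G\<^esub> inv\<^bsub>G\<^esub> h \<in> {w. (w, \<one>\<^bsub>H\<^esub>) \<in> I}"
      using I_mem[OF hc] by simp
  qed
qed

lemma subgroup_DirProd_eq_carrier_iff:
  assumes "group G" "group H" and I: "subgroup I (G \<times>\<times> H)" and onto: "snd ` I = carrier H"
  shows "I = carrier (G \<times>\<times> H) \<longleftrightarrow> carrier G \<times> {\<one>\<^bsub>H\<^esub>} \<subseteq> I"
proof
  interpret G: group G by fact
  interpret H: group H by fact
  interpret I: subgroup I "G \<times>\<times> H" by fact
  assume *: "carrier G \<times> {\<one>\<^bsub>H\<^esub>} \<subseteq> I"
  have "(p, q) \<in> I" if pq: "p \<in> carrier G" "q \<in> carrier H" for p q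
  proof -
    obtain p' where p': "(p', q) \<in> I"
      using onto pq(2) by force
    then have "p' \<in> carrier G"
      using I.subset by (auto simp: DirProd_def)
    then have "(p \<otimes>\<^bsub>G\<^esub> inv\<^bsub>G\<^esub> p', \<one>\<^bsub>H\<^esub>) \<otimes>\<^bsub>G \<times>\<times> H\<^esub> (p', q) = (p, q)"
      using pq by (simp add: G.m_assoc)
    moreover have "(p \<otimes>\<^bsub>G\<^esub> inv\<^bsub>G\<^esub> p', \<one>\<^bsub>H\<^esub>) \<in> I"
      using * pq \<open>p' \<in> carrier G\<close> by auto
    ultimately show ?thesis
      using I.m_closed p' by metis
  qed
  then show "I = carrier (G \<times>\<times> H)"
    using I.subset by (auto simp: DirProd_def)
next
  assume "I = carrier (G \<times>\<times> H)"
  then show "carrier G \<times> {\<one>\<^bsub>H\<^esub>} \<subseteq> I"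
    using group.is_monoid[OF assms(2)] by (auto simp: DirProd_def monoid.one_closed)
qed

text \<open>
  Freeness of the second factor is what bounds the subgroup from above: it makes
  \<open>free_gen s \<mapsto> u s\<close> extend to a homomorphism modulo the normal closure of \<open>Y\<close>, and every generator,
  hence every element, of the subgroup satisfies the congruence that this homomorphism defines.
\<close>

lemma generate_DirProd_free_group_subset:
  assumes "group G" and u: "u ` S \<subseteq> carrier G" and Y: "Y \<subseteq> carrier G"
    and w: "(w, \<one>\<^bsub>free_group S\<^esub>) \<in> generate (G \<times>\<times> free_group S)
      ((\<lambda>s. (u s, free_gen s)) ` S \<union> (\<lambda>y. (y, \<one>\<^bsub>free_group S\<^esub>)) ` Y)"
  shows "w \<in> normal_closure G Y"
proof -
  let ?B = "free_group S" and ?N = "normal_closure G Y"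
  let ?gens = "(\<lambda>s. (u s, free_gen s)) ` S \<union> (\<lambda>y. (y, \<one>\<^bsub>?B\<^esub>)) ` Y"
  interpret G: group G by fact
  interpret B: group ?B by (rule group_free_group)
  interpret D: group "G \<times>\<times> ?B" by (rule DirProd_group) unfold_locales
  interpret N: normal ?N G using Y by (rule G.normal_normal_closure)
  interpret Q: group "G Mod ?N" by (rule N.factorgroup_is_group)
  define \<psi> where "\<psi> = word_eval (G Mod ?N) (\<lambda>s. ?N #>\<^bsub>G\<^esub> u s)"
  have cosets: "(\<lambda>s. ?N #>\<^bsub>G\<^esub> u s) ` S \<subseteq> carrier (G Mod ?N)"
    using u by (auto simp: FactGroup_def RCOSETS_def)
  interpret \<psi>: group_hom ?B "G Mod ?N" \<psi>
    unfolding \<psi>_def using word_eval_hom(1)[OF Q.group_axioms cosets]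
    by unfold_locales
  have \<psi>_gen: "\<psi> (free_gen s) = ?N #>\<^bsub>G\<^esub> u s" if "s \<in> S" for s
    unfolding \<psi>_def using that by (rule word_eval_hom(2)[OF Q.group_axioms cosets])
  interpret \<pi>: group_hom G "G Mod ?N" "\<lambda>p. ?N #>\<^bsub>G\<^esub> p"
    using N.r_coset_hom_Mod by unfold_locales
  define E where "E = {(p, q). p \<in> carrier G \<and> q \<in> carrier ?B \<and> ?N #>\<^bsub>G\<^esub> p = \<psi> q}"
  have "subgroup E (G \<times>\<times> ?B)"
  proof (rule D.subgroupI)
    show "E \<noteq> {}"
      using \<pi>.hom_one \<psi>.hom_one by (force simp: E_def)
  next
    fix a assume "a \<in> E"
    then show "inv\<^bsub>G \<times>\<times> ?B\<^esub> a \<in> E"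
      using \<pi>.hom_inv \<psi>.hom_inv
      by (auto simp: E_def inv_DirProd G.group_axioms B.group_axioms)
  next
    fix a b assume "a \<in> E" "b \<in> E"
    then show "a \<otimes>\<^bsub>G \<times>\<times> ?B\<^esub> b \<in> E"
      using \<pi>.hom_mult \<psi>.hom_mult by (auto simp: E_def)
  qed (auto simp: E_def DirProd_def)
  moreover have "?gens \<subseteq> E"
  proof -
    have "?N #>\<^bsub>G\<^esub> y = \<psi> \<one>\<^bsub>?B\<^esub>" if "y \<in> Y" for y
      using that Y G.normal_closure_incl[of Y] G.coset_join2[OF _ N.is_subgroup] \<psi>.hom_one
      by (auto simp: FactGroup_def)
    then show ?thesis
      using u Y \<psi>_gen by (auto simp: E_def free_gen_closed)
  qed
  ultimately have "(w, \<one>\<^bsub>?B\<^esub>) \<in> E"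
    using w D.generate_subgroup_incl by blast
  then have "w \<in> carrier G" "?N #>\<^bsub>G\<^esub> w = ?N"
    using \<psi>.hom_one by (auto simp: E_def FactGroup_def)
  then show ?thesis
    using G.coset_join1[OF _ _ N.is_subgroup] N.subset by blast
qed

lemma generate_DirProd_free_group_eq_carrier_iff:
  assumes "group G" and u: "u ` S \<subseteq> carrier G" and Y: "Y \<subseteq> carrier G"
    and gen: "generate G (u ` S \<union> Y) = carrier G"
  shows "generate (G \<times>\<times> free_group S)
        ((\<lambda>s. (u s, free_gen s)) ` S \<union> (\<lambda>y. (y, \<one>\<^bsub>free_group S\<^esub>)) ` Y)
      = carrier (G \<times>\<times> free_group S)
    \<longleftrightarrow> normal_closure G Y = carrier G"
proof -
  let ?B = "free_group S" and ?N = "normal_closure G Y"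
  let ?gens = "(\<lambda>s. (u s, free_gen s)) ` S \<union> (\<lambda>y. (y, \<one>\<^bsub>?B\<^esub>)) ` Y"
  interpret G: group G by fact
  interpret B: group ?B by (rule group_free_group)
  interpret D: group "G \<times>\<times> ?B" by (rule DirProd_group) unfold_locales
  define I where "I = generate (G \<times>\<times> ?B) ?gens"
  have gens: "?gens \<subseteq> carrier (G \<times>\<times> ?B)"
    using u Y by (auto simp: DirProd_def free_gen_closed)
  have I: "subgroup I (G \<times>\<times> ?B)"
    unfolding I_def by (rule D.generate_is_subgroup[OF gens])
  interpret fst: group_hom "G \<times>\<times> ?B" G fst
    by unfold_locales (auto simp: hom_def DirProd_def)
  interpret snd: group_hom "G \<times>\<times> ?B" ?B snd
    by unfold_locales (auto simp: hom_def DirProd_def)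
  have "fst ` ?gens = u ` S \<union> Y"
    by (simp add: image_Un image_image)
  then have fst_I: "fst ` I = carrier G"
    unfolding I_def fst.generate_img[OF gens, symmetric] by (simp add: gen)
  have snd_I: "snd ` I = carrier ?B"
  proof
    show "snd ` I \<subseteq> carrier ?B"
      using subgroup.subset[OF I] by (auto simp: DirProd_def)
    have "free_gen ` S \<subseteq> snd ` ?gens"
      by (force simp: image_Un image_image)
    then have "generate ?B (free_gen ` S) \<subseteq> snd ` I"
      unfolding I_def snd.generate_img[OF gens, symmetric]
      by (rule B.mono_generate)
    then show "carrier ?B \<subseteq> snd ` I"
      by (simp add: free_group_generate)
  qed
  have "?N = {w. (w, \<one>\<^bsub>?B\<^esub>) \<in> I}"
  proof
    have "Y \<subseteq> {w. (w, \<one>\<^bsub>?B\<^esub>) \<in> I}"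
      unfolding I_def by (auto intro: generate.incl)
    then show "?N \<subseteq> {w. (w, \<one>\<^bsub>?B\<^esub>) \<in> I}"
      by (rule G.normal_closure_minimal)
        (rule normal_slice_DirProd[OF G.group_axioms B.group_axioms I fst_I])
    show "{w. (w, \<one>\<^bsub>?B\<^esub>) \<in> I} \<subseteq> ?N"
      unfolding I_def using generate_DirProd_free_group_subset[OF assms(1) u Y] by blast
  qed
  then have "carrier G \<times> {\<one>\<^bsub>?B\<^esub>} \<subseteq> I \<longleftrightarrow> carrier G \<subseteq> ?N"
    by auto
  also have "\<dots> \<longleftrightarrow> ?N = carrier G"
    using normal_imp_subgroup[OF G.normal_normal_closure[OF Y]] subgroup.subset by blast
  finally show ?thesis
    using subgroup_DirProd_eq_carrier_iff[OF G.group_axioms B.group_axioms I snd_I]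
    unfolding I_def by simp
qed

section \<open>Surjectivity onto the product of two free groups\<close>

theorem theorem1p3:
  fixes g :: nat
    and \<phi> :: "surface_letter word set \<Rightarrow> nat word \<times> nat word"
    and u v :: "nat \<Rightarrow> nat word"
  assumes "g \<ge> 1"
    and "\<phi> \<in> hom (surface_group g) (free_group_rank g \<times>\<times> free_group_rank g)"
    and "\<And>i. i \<in> {1..g} \<Longrightarrow> u i \<in> carrier (free_group_rank g)"
    and "\<And>i. i \<in> {1..g} \<Longrightarrow> v i \<in> carrier (free_group_rank g)"
    and "\<And>i. i \<in> {1..g} \<Longrightarrow> \<phi> (surface_x g i) = (u i, free_gen i)"
    and "\<And>i. i \<in> {1..g} \<Longrightarrow> \<phi> (surface_y g i) = (v i, \<one>\<^bsub>free_group_rank g\<^esub>)"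
    and "commutator_prod (free_group_rank g) g u v = \<one>\<^bsub>free_group_rank g\<^esub>"
    and "generate (free_group_rank g) (u ` {1..g} \<union> v ` {1..g}) = carrier (free_group_rank g)"
  shows "\<phi> ` carrier (surface_group g) = carrier (free_group_rank g \<times>\<times> free_group_rank g)
    \<longleftrightarrow> trivial_group (presented_group {1..g} (v ` {1..g}))"
proof -
  let ?F = "free_group_rank g" and ?J = "{1..g}"
  let ?gens = "surface_x g ` ?J \<union> surface_y g ` ?J"
  have F: "group ?F" by (rule group_free_group)
  have \<phi>: "group_hom (surface_group g) (?F \<times>\<times> ?F) \<phi>"
    using assms(2)
    by (intro group_hom.intro group_hom_axioms.intro group_surface_group DirProd_group F)
  have u: "u ` ?J \<subseteq> carrier ?F" and v: "v ` ?J \<subseteq> carrier ?F"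
    using assms(3,4) by auto
  have "?gens \<subseteq> carrier (surface_group g)"
    using surface_group_generate[of g] generate.incl[of _ ?gens "surface_group g"] by blast
  then have "\<phi> ` carrier (surface_group g) = generate (?F \<times>\<times> ?F) (\<phi> ` ?gens)"
    using group_hom.generate_img[OF \<phi>] surface_group_generate[of g] by metis
  also have "\<phi> ` ?gens
      = (\<lambda>i. (u i, free_gen i)) ` ?J \<union> (\<lambda>y. (y, \<one>\<^bsub>?F\<^esub>)) ` v ` ?J"
    unfolding image_Un image_image using assms(5,6) by (auto cong: image_cong_simp)
  finally show ?thesis
    using generate_DirProd_free_group_eq_carrier_iff[OF F u v assms(8)]
      trivial_presented_group_iff[OF v] by simp
qed

end
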